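(* (a) $\overline{K(\beta\mathbb{N},\cdot)}\subset MAX$, where the inclusion is strict and $\overline{K(\beta\mathbb{N},\cdot)}$ denotes the topological closure of $K(\beta\mathbb{N},\cdot)$ in $\beta\mathbb{N}$. (b) $K(\beta\mathbb{N},+)\not\subseteq MAX$.
   Context: $\mathbb{N}$ is the set of positive integers and $\beta\mathbb{N}$ the set of all ultrafilters on $\mathbb{N}$, with the topology generated by the sets $\overline{A}=\{\mathcal{F}\in\beta\mathbb{N}:A\in\mathcal{F}\}$, $A\subseteq\mathbb{N}$. For $A\subseteq\mathbb{N}$ and $n\in\mathbb{N}$, $A/n=\{a/n:a\in A,\ n\mid a\}$ and $A-n=\{a-n:a\in A,\ a>n\}$; for $\mathcal{F},\mathcal{G}\in\beta\mathbb{N}$, $\mathcal{F}\cdot\mathcal{G}=\{A\subseteq\mathbb{N}:\{n\in\mathbb{N}:A/n\in\mathcal{G}\}\in\mathcal{F}\}$ and $\mathcal{F}+\mathcal{G}=\{A\subseteq\mathbb{N}:\{n\in\mathbb{N}:A-n\in\mathcal{G}\}\in\mathcal{F}\}$. Then $(\beta\mathbb{N},\cdot)$ and $(\beta\mathbb{N},+)$ are compact Hausdorff right-topological semigroups, and $K(\beta\mathbb{N},\cdot)$, $K(\beta\mathbb{N},+)$ denote their smallest (two-sided) ideals. For $A\subseteq\mathbb{N}$, $A\!\uparrow\;=\{n\in\mathbb{N}:(\exists a\in A)\ a\mid n\}$, and $\mathcal{F}\,\widetilde{\mid}\,\mathcal{G}$ means that $A\!\uparrow\;\in\mathcal{G}$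 for every $A\in\mathcal{F}$. $MAX$ is the $\widetilde{\mid}$-greatest class, i.e. the set of all $\mathcal{G}\in\beta\mathbb{N}$ such that $\mathcal{F}\,\widetilde{\mid}\,\mathcal{G}$ for all $\mathcal{F}\in\beta\mathbb{N}$; equivalently, the set of all $\mathcal{G}\in\beta\mathbb{N}$ containing every nonempty $A\subseteq\mathbb{N}$ with $A=A\!\uparrow$. *)

theory Defs
  imports "HOL-Analysis.Analysis"
begin

text \<open>
  The positive integers are the subset \<open>{0<..}\<close> of \<^typ>\<open>nat\<close>; an ultrafilter on them is a set of
  subsets of \<open>{0<..}\<close>, and all complements and set operations below are relative to \<open>{0<..}\<close>.
\<close>

abbreviation posnat :: "nat set" where
  "posnat \<equiv> {0<..}"

definition ultrafilter_on :: "'a set \<Rightarrow> 'a set set \<Rightarrow> bool" where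
  "ultrafilter_on X F \<longleftrightarrow>
     F \<subseteq> Pow X \<and> X \<in> F \<and> {} \<notin> F \<and>
     (\<forall>A\<in>F. \<forall>B\<in>F. A \<inter> B \<in> F) \<and>
     (\<forall>A\<in>F. \<forall>B. A \<subseteq> B \<and> B \<subseteq> X \<longrightarrow> B \<in> F) \<and>
     (\<forall>A. A \<subseteq> X \<longrightarrow> A \<in> F \<or> X - A \<in> F)"

definition betaN :: "nat set set set" where
  "betaN = {F. ultrafilter_on posnat F}"

definition betaN_topology :: "nat set set topology" where
  "betaN_topology = topology_generated_by {{F \<in> betaN. A \<in> F} | A. A \<subseteq> posnat}"

definition set_quot :: "nat set \<Rightarrow> nat \<Rightarrow> nat set" where
  "set_quot A n = {a div n | a. a \<in> A \<and> n dvd a}"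

definition set_shift :: "nat set \<Rightarrow> nat \<Rightarrow> nat set" where
  "set_shift A n = {a - n | a. a \<in> A \<and> a > n}"

definition uf_mult :: "nat set set \<Rightarrow> nat set set \<Rightarrow> nat set set" where
  "uf_mult F G = {A. A \<subseteq> posnat \<and> {n \<in> posnat. set_quot A n \<in> G} \<in> F}"

definition uf_add :: "nat set set \<Rightarrow> nat set set \<Rightarrow> nat set set" where
  "uf_add F G = {A. A \<subseteq> posnat \<and> {n \<in> posnat. set_shift A n \<in> G} \<in> F}"

definition two_sided_ideal :: "'a set \<Rightarrow> ('a \<Rightarrow> 'a \<Rightarrow> 'a) \<Rightarrow> 'a set \<Rightarrow> bool" where
  "two_sided_ideal S f I \<longleftrightarrow>
     I \<noteq> {} \<and> I \<subseteq> S \<and> (\<forall>x\<in>I. \<forall>s\<in>S. f s x \<in> I \<and> f x s \<in> I)"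

text \<open>
  Here \<open>LEAST\<close> refers to the inclusion order on sets. The value is meaningful only if a smallest
  ideal exists, as it does in every compact Hausdorff right-topological semigroup.
\<close>

definition smallest_ideal :: "'a set \<Rightarrow> ('a \<Rightarrow> 'a \<Rightarrow> 'a) \<Rightarrow> 'a set" where
  "smallest_ideal S f = (LEAST I. two_sided_ideal S f I)"

definition mult_upset :: "nat set \<Rightarrow> nat set" where
  "mult_upset A = {n \<in> posnat. \<exists>a\<in>A. a dvd n}"

definition uf_dvd :: "nat set set \<Rightarrow> nat set set \<Rightarrow> bool" where
  "uf_dvd F G \<longleftrightarrow> (\<forall>A\<in>F. mult_upset A \<in> G)"

definition max_class :: "nat set set set" where
  "max_class = {G \<in> betaN. \<forall>F\<in>betaN. uf_dvd F G}"

end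

theory Submission
  imports Defs
begin

text \<open>
  An ultrafilter \<open>G\<close> lies in \<open>MAX\<close> iff it contains the set of multiples
  of every positive integer (\<open>max_class_iff\<close>). This description makes \<open>MAX\<close> a two-sided ideal of
  \<open>(\<beta>\<nat>, \<cdot>)\<close>, so it contains the smallest ideal \<open>K\<close>; and \<open>MAX\<close> is closed, being cut out by
  membership conditions on \<open>G\<close>, so it contains the closure of \<open>K\<close> as well.

  The inclusion is strict because of the set \<open>A\<close> of factorials. It contains a multiple of every
  positive integer, so some ultrafilter in \<open>MAX\<close> contains \<open>A\<close>. On the other hand \<open>A\<close> is so sparse
  that for \<open>n \<noteq> m\<close> only finitely many \<open>x\<close> have both \<open>n x\<close> and \<open>m x\<close> in \<open>A\<close>, and therefore no
  product of two ultrafilters in \<open>MAX\<close> contains \<open>A\<close>. Such products form an ideal, hence no member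
  of \<open>K\<close> contains \<open>A\<close>, and no ultrafilter containing \<open>A\<close> lies in the closure of \<open>K\<close>.

  For the additive part, \<open>K(\<beta>\<nat>, +)\<close> is closed under adding the principal ultrafilter at \<open>1\<close>, which
  turns an ultrafilter containing the even numbers into one containing the odd numbers.

  All this presupposes that smallest ideals exist. That is proved for the ultrafilters on an
  arbitrary semigroup, with closed left ideals replaced by the filters defining them: a maximal
  translation-invariant filter base \<open>\<Phi>\<close> (Zorn) defines a minimal left ideal, namely the set \<open>L\<close> of
  all ultrafilters containing \<open>\<Phi>\<close>, and the smallest ideal is \<open>L\<close> multiplied by the whole semigroup.
\<close>

section \<open>Extending filter bases to ultrafilters\<close>

definition filter_base_on :: "'a set \<Rightarrow> 'a set set \<Rightarrow> bool" where
  "filter_base_on X E \<longleftrightarrow>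
     E \<noteq> {} \<and> E \<subseteq> Pow X \<and> {} \<notin> E \<and> (\<forall>A\<in>E. \<forall>B\<in>E. A \<inter> B \<in> E)"

lemma filter_base_on_Union_chain:
  assumes "C \<noteq> {}" and base: "\<And>E. E \<in> C \<Longrightarrow> filter_base_on X E"
    and lin: "\<And>E F. E \<in> C \<Longrightarrow> F \<in> C \<Longrightarrow> E \<subseteq> F \<or> F \<subseteq> E"
  shows "filter_base_on X (\<Union>C)"
  unfolding filter_base_on_def
proof (intro conjI ballI)
  fix A B assume "A \<in> \<Union>C" "B \<in> \<Union>C"
  then obtain E F where "E \<in> C" "A \<in> E" "F \<in> C" "B \<in> F" by blast
  with lin[of E F] obtain D where "D \<in> C" "A \<in> D" "B \<in> D" by blast
  with base[of D] show "A \<inter> B \<in> \<Union>C" unfolding filter_base_on_def by blast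
next
  have "E \<noteq> {} \<and> E \<subseteq> Pow X \<and> {} \<notin> E" if "E \<in> C" for E
    using base[OF that] by (simp add: filter_base_on_def)
  then show "\<Union>C \<noteq> {}" "\<Union>C \<subseteq> Pow X" "{} \<notin> \<Union>C" using assms(1) by blast+
qed

text \<open>
  A maximal filter base already contains every set that meets all its members, since such a set
  and its traces can be adjoined. Upward closure and the decision between a set and its complement
  both follow from this.
\<close>

lemma ultrafilter_on_extends_filter_base:
  assumes E: "filter_base_on X E"
  obtains U where "ultrafilter_on X U" "E \<subseteq> U"
proof -
  define \<A> where "\<A> = {F. filter_base_on X F \<and> E \<subseteq> F}"
  have "\<exists>M\<in>\<A>. \<forall>F\<in>\<A>. M \<subseteq> F \<longrightarrow> F = M"
  proof (rule subset_Zorn_nonempty)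
    show "\<A> \<noteq> {}" using E by (auto simp: \<A>_def)
    fix C assume "C \<noteq> {}" and C: "subset.chain \<A> C"
    moreover have "filter_base_on X (\<Union>C)"
      using \<open>C \<noteq> {}\<close> C by (intro filter_base_on_Union_chain) (auto simp: subset_chain_def \<A>_def)
    moreover have "E \<subseteq> \<Union>C"
      using \<open>C \<noteq> {}\<close> C by (fastforce simp: subset_chain_def \<A>_def)
    ultimately show "\<Union>C \<in> \<A>" by (simp add: \<A>_def)
  qed
  then obtain M where "M \<in> \<A>" and max: "\<And>F. F \<in> \<A> \<Longrightarrow> M \<subseteq> F \<Longrightarrow> F = M" by blast
  then have EM: "E \<subseteq> M" and MX: "M \<subseteq> Pow X" and nonempty: "M \<noteq> {}" "{} \<notin> M"
    and inter: "\<And>A B. A \<in> M \<Longrightarrow> B \<in> M \<Longrightarrow> A \<inter> B \<in> M"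
    by (auto simp: \<A>_def filter_base_on_def)
  have adjoin: "A \<in> M" if A: "A \<subseteq> X" and meets: "\<And>B. B \<in> M \<Longrightarrow> A \<inter> B \<noteq> {}" for A
  proof -
    have "insert A M \<union> (\<inter>) A ` M \<in> \<A>"
      unfolding \<A>_def filter_base_on_def mem_Collect_eq
    proof (intro conjI ballI)
      fix P Q assume "P \<in> insert A M \<union> (\<inter>) A ` M" "Q \<in> insert A M \<union> (\<inter>) A ` M"
      moreover have "A \<inter> (A \<inter> B) = A \<inter> B" "A \<inter> B \<inter> A = A \<inter> B" "B \<inter> A = A \<inter> B"
        "A \<inter> B \<inter> (A \<inter> C) = A \<inter> (B \<inter> C)" "A \<inter> B \<inter> C = A \<inter> (B \<inter> C)"
        "B \<inter> (A \<inter> C) = A \<inter> (B \<inter> C)" for B C by blast+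
      ultimately show "P \<inter> Q \<in> insert A M \<union> (\<inter>) A ` M"
        by (elim UnE insertE imageE) (simp_all add: inter)
    next
      show "{} \<notin> insert A M \<union> (\<inter>) A ` M" using nonempty meets by blast
    qed (use EM MX A in auto)
    then show ?thesis using max by blast
  qed
  have up: "B \<in> M" if "A \<in> M" "A \<subseteq> B" "B \<subseteq> X" for A B
  proof (rule adjoin)
    fix C assume "C \<in> M"
    then have "A \<inter> C \<noteq> {}" using inter[OF that(1)] nonempty(2) by metis
    then show "B \<inter> C \<noteq> {}" using that(2) by blast
  qed (rule that(3))
  have "A \<in> M \<or> X - A \<in> M" if "A \<subseteq> X" for A
  proof (cases "A \<in> M")
    case False
    then obtain B where "B \<in> M" "A \<inter> B = {}" using adjoin[OF \<open>A \<subseteq> X\<close>] by metis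
    then have "B \<subseteq> X - A" using MX by auto
    then show ?thesis using up[OF \<open>B \<in> M\<close>] by simp
  qed simp
  moreover have "X \<in> M"
  proof -
    obtain B where "B \<in> M" using nonempty(1) by blast
    with MX show ?thesis using up[OF \<open>B \<in> M\<close>, of X] by auto
  qed
  ultimately have "ultrafilter_on X M"
    unfolding ultrafilter_on_def
  proof (intro conjI ballI allI impI)
    show "B \<in> M" if "A \<in> M" "A \<subseteq> B \<and> B \<subseteq> X" for A B using up[OF that(1)] that(2) by simp
  qed (use MX nonempty(2) inter in simp_all)
  with EM that show thesis by blast
qed

lemma
  assumes "ultrafilter_on X F"
  shows ultrafilter_on_subset: "A \<in> F \<Longrightarrow> A \<subseteq> X"
    and ultrafilter_on_carrier: "X \<in> F"
    and ultrafilter_on_Int: "A \<in> F \<Longrightarrow> B \<in> F \<Longrightarrow> A \<inter> B \<in> F"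
    and ultrafilter_on_mono: "A \<in> F \<Longrightarrow> A \<subseteq> B \<Longrightarrow> B \<subseteq> X \<Longrightarrow> B \<in> F"
    and ultrafilter_on_nonempty: "A \<in> F \<Longrightarrow> A \<noteq> {}"
  using assms unfolding ultrafilter_on_def by blast+

lemma ultrafilter_on_Diff_iff:
  assumes "ultrafilter_on X F" "A \<subseteq> X"
  shows "X - A \<in> F \<longleftrightarrow> A \<notin> F"
  using assms unfolding ultrafilter_on_def by (metis Diff_disjoint)

lemma ultrafilter_on_eqI:
  assumes F: "ultrafilter_on X F" and G: "ultrafilter_on X G" and "F \<subseteq> G"
  shows "F = G"
proof
  show "G \<subseteq> F"
  proof
    fix A assume "A \<in> G"
    then have "A \<subseteq> X" "X - A \<notin> G"
      using ultrafilter_on_subset[OF G] ultrafilter_on_Diff_iff[OF G] by blast+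
    then show "A \<in> F" using ultrafilter_on_Diff_iff[OF F] \<open>F \<subseteq> G\<close> by blast
  qed
qed fact

definition principal_ultrafilter :: "'a set \<Rightarrow> 'a \<Rightarrow> 'a set set" where
  "principal_ultrafilter X a = {A. A \<subseteq> X \<and> a \<in> A}"

lemma ultrafilter_on_principal: "a \<in> X \<Longrightarrow> ultrafilter_on X (principal_ultrafilter X a)"
  unfolding ultrafilter_on_def principal_ultrafilter_def by auto

section \<open>The smallest ideal of the ultrafilters on a semigroup\<close>

locale semigroup_on =
  fixes X :: "'a set" and mul :: "'a \<Rightarrow> 'a \<Rightarrow> 'a" (infixl "\<cdot>" 70)
  assumes carrier_nonempty: "X \<noteq> {}"
    and mul_closed: "\<And>a b. a \<in> X \<Longrightarrow> b \<in> X \<Longrightarrow> a \<cdot> b \<in> X"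
    and mul_assoc: "\<And>a b c. a \<in> X \<Longrightarrow> b \<in> X \<Longrightarrow> c \<in> X \<Longrightarrow> a \<cdot> b \<cdot> c = a \<cdot> (b \<cdot> c)"
begin

text \<open>
  For multiplication of positive integers this is \<open>A / n\<close>, for addition it is \<open>A - n\<close>.
\<close>

definition left_quot :: "'a set \<Rightarrow> 'a \<Rightarrow> 'a set" where
  "left_quot A n = {m \<in> X. n \<cdot> m \<in> A}"

definition uf_prod :: "'a set set \<Rightarrow> 'a set set \<Rightarrow> 'a set set" where
  "uf_prod F G = {A. A \<subseteq> X \<and> {n \<in> X. left_quot A n \<in> G} \<in> F}"

definition beta :: "'a set set set" where
  "beta = {F. ultrafilter_on X F}"

lemma betaD: "F \<in> beta \<Longrightarrow> ultrafilter_on X F"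
  by (simp add: beta_def)

lemma left_quot_subset: "left_quot A n \<subseteq> X"
  and left_quot_empty: "left_quot {} n = {}"
  and left_quot_Int: "left_quot (A \<inter> B) n = left_quot A n \<inter> left_quot B n"
  and left_quot_mono: "A \<subseteq> B \<Longrightarrow> left_quot A n \<subseteq> left_quot B n"
  by (auto simp: left_quot_def)

lemma left_quot_carrier: "n \<in> X \<Longrightarrow> left_quot X n = X"
  and left_quot_Diff: "n \<in> X \<Longrightarrow> left_quot (X - A) n = X - left_quot A n"
  and left_quot_left_quot:
    "n \<in> X \<Longrightarrow> m \<in> X \<Longrightarrow> left_quot (left_quot A n) m = left_quot A (n \<cdot> m)"
  using mul_closed mul_assoc by (auto simp: left_quot_def)

lemma left_quot_Int_mem_iff:
  assumes "G \<in> beta"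
  shows "left_quot (A \<inter> B) n \<in> G \<longleftrightarrow> left_quot A n \<in> G \<and> left_quot B n \<in> G"
  using ultrafilter_on_Int[OF betaD[OF assms]] ultrafilter_on_mono[OF betaD[OF assms]]
  by (metis inf.cobounded1 inf.cobounded2 left_quot_Int left_quot_subset)

lemma uf_prod_closed:
  assumes F: "F \<in> beta" and G: "G \<in> beta"
  shows "uf_prod F G \<in> beta"
proof -
  note f = betaD[OF F] and g = betaD[OF G]
  define D where "D A = {n \<in> X. left_quot A n \<in> G}" for A
  have mem: "A \<in> uf_prod F G \<longleftrightarrow> A \<subseteq> X \<and> D A \<in> F" for A by (simp add: uf_prod_def D_def)
  have [simp]: "D X = X" "D {} = {}"
    using ultrafilter_on_carrier[OF g] ultrafilter_on_nonempty[OF g]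
    by (auto simp: D_def left_quot_carrier left_quot_empty)
  have [simp]: "D (A \<inter> B) = D A \<inter> D B" for A B
    by (auto simp: D_def left_quot_Int_mem_iff[OF G])
  have D_Diff: "D (X - A) = X - D A" for A
    by (auto simp: D_def left_quot_Diff ultrafilter_on_Diff_iff[OF g] left_quot_subset)
  have D_mono: "D A \<subseteq> D B" if "A \<subseteq> B" for A B
    unfolding D_def using ultrafilter_on_mono[OF g _ left_quot_mono[OF that] left_quot_subset] by blast
  have DX: "D A \<subseteq> X" for A by (auto simp: D_def)
  have "ultrafilter_on X (uf_prod F G)"
    unfolding ultrafilter_on_def
  proof (intro conjI ballI allI impI)
    show "{} \<notin> uf_prod F G" using ultrafilter_on_nonempty[OF f] by (auto simp: mem)
    show "B \<in> uf_prod F G" if "A \<in> uf_prod F G" "A \<subseteq> B \<and> B \<subseteq> X" for A B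
      using that ultrafilter_on_mono[OF f _ D_mono DX] by (auto simp: mem)
    show "A \<in> uf_prod F G \<or> X - A \<in> uf_prod F G" if "A \<subseteq> X" for A
      using that by (auto simp: mem D_Diff ultrafilter_on_Diff_iff[OF f DX])
  qed (auto simp: mem ultrafilter_on_carrier[OF f] intro: ultrafilter_on_Int[OF f])
  then show ?thesis by (simp add: beta_def)
qed

lemma uf_prod_assoc: "uf_prod (uf_prod F G) H = uf_prod F (uf_prod G H)"
proof -
  have "{n \<in> X. left_quot {k \<in> X. left_quot A k \<in> H} n \<in> G}
      = {n \<in> X. left_quot A n \<in> uf_prod G H}" for A
  proof (rule Collect_cong, rule conj_cong[OF refl])
    fix n assume n: "n \<in> X"
    then have "left_quot {k \<in> X. left_quot A k \<in> H} n
        = {m \<in> X. left_quot (left_quot A n) m \<in> H}"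
      by (auto simp: left_quot_def[of "Collect _"] mul_closed left_quot_left_quot)
    then show "left_quot {k \<in> X. left_quot A k \<in> H} n \<in> G \<longleftrightarrow> left_quot A n \<in> uf_prod G H"
      by (simp add: uf_prod_def left_quot_subset)
  qed
  then show ?thesis
    unfolding uf_prod_def[of "uf_prod F G" H] uf_prod_def[of F "uf_prod G H"]
    by (simp add: uf_prod_def[of F G])
qed

text \<open>
  The product by a fixed right factor \<open>G\<close> is continuous, so that its range is compact and hence
  closed. In terms of filters: an ultrafilter \<open>H\<close> containing all sets common to the range is in it.
  A left factor for \<open>H\<close> must contain the sets \<open>{n. A/n \<in> G}\<close> with \<open>A \<in> H\<close>. None of them is empty,
  since otherwise the complement of \<open>A\<close> would be common to the range; so they form a filter base,
  and any ultrafilter extending it will do.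
\<close>

lemma range_uf_prod_closed:
  assumes G: "G \<in> beta" and H: "H \<in> beta"
    and common: "\<And>A. A \<subseteq> X \<Longrightarrow> (\<And>n. n \<in> X \<Longrightarrow> left_quot A n \<in> G) \<Longrightarrow> A \<in> H"
  obtains F where "F \<in> beta" "H = uf_prod F G"
proof -
  note g = betaD[OF G] and h = betaD[OF H]
  define D where "D A = {n \<in> X. left_quot A n \<in> G}" for A
  have D_Int: "D A \<inter> D B = D (A \<inter> B)" for A B
    by (auto simp: D_def left_quot_Int_mem_iff[OF G])
  have D_nonempty: "D A \<noteq> {}" if "A \<in> H" for A
  proof
    assume "D A = {}"
    then have "left_quot (X - A) n \<in> G" if "n \<in> X" for n
      using that by (auto simp: D_def left_quot_Diff ultrafilter_on_Diff_iff[OF g left_quot_subset])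
    then have "X - A \<in> H" using common by blast
    then show False using ultrafilter_on_Diff_iff[OF h] ultrafilter_on_subset[OF h] that by blast
  qed
  have "filter_base_on X (D ` H)"
    unfolding filter_base_on_def
    using D_nonempty ultrafilter_on_carrier[OF h] ultrafilter_on_Int[OF h]
    by (auto simp: D_Int) (auto simp: D_def)
  then obtain F where F: "ultrafilter_on X F" "D ` H \<subseteq> F"
    using ultrafilter_on_extends_filter_base by blast
  then have Fb: "F \<in> beta" by (simp add: beta_def)
  have "H \<subseteq> uf_prod F G"
    using F(2) ultrafilter_on_subset[OF h] by (auto simp: uf_prod_def D_def)
  then have "H = uf_prod F G"
    using ultrafilter_on_eqI h betaD[OF uf_prod_closed[OF Fb G]] by blast
  with Fb that show thesis by blast
qed

text \<open>
  Invariance under quotients says that the ultrafilters containing \<open>E\<close> form a left ideal, which is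
  closed and nonempty. Larger bases define smaller ideals.
\<close>

definition invariant_base :: "'a set set \<Rightarrow> bool" where
  "invariant_base E \<longleftrightarrow>
     filter_base_on X E \<and> X \<in> E \<and> (\<forall>A\<in>E. \<forall>n\<in>X. left_quot A n \<in> E)"

text \<open>
  If \<open>\<Phi>\<close> is a maximal invariant base and the ultrafilter \<open>G\<close> contains \<open>\<Phi>\<close>, then the sets all of
  whose quotients lie in \<open>G\<close> form an invariant base containing \<open>\<Phi>\<close>, hence equal to \<open>\<Phi>\<close>. As these are
  the sets common to the range of the product by \<open>G\<close>, that range is all of the ultrafilters
  containing \<open>\<Phi>\<close>: they form a left ideal \<open>L\<close> that each of its members generates.
\<close>

lemma minimal_left_ideal_exists:
  obtains L where "L \<noteq> {}" "L \<subseteq> beta"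
    and "\<And>F G. F \<in> beta \<Longrightarrow> G \<in> L \<Longrightarrow> uf_prod F G \<in> L"
    and "\<And>G H. G \<in> L \<Longrightarrow> H \<in> L \<Longrightarrow> \<exists>F\<in>beta. H = uf_prod F G"
proof -
  have "\<exists>M\<in>Collect invariant_base. \<forall>E\<in>Collect invariant_base. M \<subseteq> E \<longrightarrow> E = M"
  proof (rule subset_Zorn_nonempty)
    have "invariant_base {X}"
      using carrier_nonempty by (auto simp: invariant_base_def filter_base_on_def left_quot_carrier)
    then show "Collect invariant_base \<noteq> {}" by blast
    fix C assume "C \<noteq> {}" and C: "subset.chain (Collect invariant_base) C"
    moreover have "filter_base_on X (\<Union>C)"
      using \<open>C \<noteq> {}\<close> C
      by (intro filter_base_on_Union_chain) (auto simp: subset_chain_def invariant_base_def)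
    moreover have "X \<in> E" "\<forall>A\<in>E. \<forall>n\<in>X. left_quot A n \<in> E" if "E \<in> C" for E
      using C that by (auto simp: subset_chain_def invariant_base_def)
    ultimately show "\<Union>C \<in> Collect invariant_base"
      unfolding invariant_base_def by blast
  qed
  then obtain \<Phi> where inv: "invariant_base \<Phi>"
    and max: "\<And>E. invariant_base E \<Longrightarrow> \<Phi> \<subseteq> E \<Longrightarrow> E = \<Phi>" by blast
  then have base: "filter_base_on X \<Phi>" and \<Phi>X: "\<And>A. A \<in> \<Phi> \<Longrightarrow> A \<subseteq> X"
    and quot: "\<And>A n. A \<in> \<Phi> \<Longrightarrow> n \<in> X \<Longrightarrow> left_quot A n \<in> \<Phi>"
    by (auto simp: invariant_base_def filter_base_on_def)
  define L where "L = {G \<in> beta. \<Phi> \<subseteq> G}"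
  show thesis
  proof
    show "L \<noteq> {}"
      using ultrafilter_on_extends_filter_base[OF base] by (auto simp: L_def beta_def)
    show "L \<subseteq> beta" by (auto simp: L_def)
    fix G assume "G \<in> L"
    then have G: "G \<in> beta" "\<Phi> \<subseteq> G" by (auto simp: L_def)
    note g = betaD[OF G(1)]
    show "uf_prod F G \<in> L" if F: "F \<in> beta" for F
    proof -
      have "A \<in> uf_prod F G" if "A \<in> \<Phi>" for A
      proof -
        have "{n \<in> X. left_quot A n \<in> G} = X" using quot[OF that] G(2) by blast
        then show ?thesis
          using \<Phi>X[OF that] ultrafilter_on_carrier[OF betaD[OF F]] by (simp add: uf_prod_def)
      qed
      then show ?thesis using uf_prod_closed[OF F G(1)] by (auto simp: L_def)
    qed
    define \<Psi> where "\<Psi> = {A. A \<subseteq> X \<and> (\<forall>n\<in>X. left_quot A n \<in> G)}"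
    have "{} \<notin> \<Psi>"
      using carrier_nonempty ultrafilter_on_nonempty[OF g] by (auto simp: \<Psi>_def left_quot_empty)
    moreover have "X \<in> \<Psi>"
      using ultrafilter_on_carrier[OF g] by (simp add: \<Psi>_def left_quot_carrier)
    moreover have "A \<inter> B \<in> \<Psi>" if "A \<in> \<Psi>" "B \<in> \<Psi>" for A B
      using that by (auto simp: \<Psi>_def left_quot_Int_mem_iff[OF G(1)])
    moreover have "left_quot A n \<in> \<Psi>" if "A \<in> \<Psi>" "n \<in> X" for A n
      using that by (simp add: \<Psi>_def left_quot_subset left_quot_left_quot mul_closed)
    moreover have "\<Psi> \<subseteq> Pow X" by (auto simp: \<Psi>_def)
    ultimately have "invariant_base \<Psi>"
      unfolding invariant_base_def filter_base_on_def by blast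
    moreover have "\<Phi> \<subseteq> \<Psi>" using \<Phi>X quot G(2) by (auto simp: \<Psi>_def)
    ultimately have "\<Psi> = \<Phi>" by (rule max)
    show "\<exists>F\<in>beta. H = uf_prod F G" if "H \<in> L" for H
    proof -
      have H: "H \<in> beta" "\<Psi> \<subseteq> H" using that \<open>\<Psi> = \<Phi>\<close> by (auto simp: L_def)
      show ?thesis
        by (rule range_uf_prod_closed[OF G(1) H(1)]) (use H(2) in \<open>auto simp: \<Psi>_def\<close>)
    qed
  qed
qed

text \<open>
  With \<open>L\<close> a minimal left ideal, \<open>L \<cdot> \<beta>X\<close> is a two-sided ideal, and every ideal \<open>I\<close> contains it:
  \<open>I\<close> meets \<open>L\<close> because it contains \<open>i \<cdot> l\<close>, so it contains \<open>L\<close> by minimality.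
\<close>

theorem smallest_ideal_beta:
  shows two_sided_ideal_smallest_ideal: "two_sided_ideal beta uf_prod (smallest_ideal beta uf_prod)"
    and smallest_ideal_subset: "\<And>I. two_sided_ideal beta uf_prod I \<Longrightarrow> smallest_ideal beta uf_prod \<subseteq> I"
proof -
  obtain L where L: "L \<noteq> {}" "L \<subseteq> beta"
    and left: "\<And>F G. F \<in> beta \<Longrightarrow> G \<in> L \<Longrightarrow> uf_prod F G \<in> L"
    and minimal: "\<And>G H. G \<in> L \<Longrightarrow> H \<in> L \<Longrightarrow> \<exists>F\<in>beta. H = uf_prod F G"
    by (rule minimal_left_ideal_exists) blast
  define K where "K = {uf_prod l s | l s. l \<in> L \<and> s \<in> beta}"
  have K: "two_sided_ideal beta uf_prod K"
    unfolding two_sided_ideal_def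
  proof (intro conjI ballI)
    show "K \<noteq> {}" "K \<subseteq> beta" using L uf_prod_closed by (auto simp: K_def)
    fix x s assume "x \<in> K" and s: "s \<in> beta"
    then obtain l t where x: "x = uf_prod l t" "l \<in> L" "t \<in> beta" by (auto simp: K_def)
    have "uf_prod s x = uf_prod (uf_prod s l) t" "uf_prod s l \<in> L"
      using left s x by (simp_all add: uf_prod_assoc)
    then show "uf_prod s x \<in> K" using x(3) unfolding K_def by blast
    have "uf_prod x s = uf_prod l (uf_prod t s)" "uf_prod t s \<in> beta"
      using s x uf_prod_closed by (simp_all add: uf_prod_assoc)
    then show "uf_prod x s \<in> K" using x(2) unfolding K_def by blast
  qed
  have least: "K \<subseteq> I" if I: "two_sided_ideal beta uf_prod I" for I
  proof -
    obtain i l where "i \<in> I" "i \<in> beta" "l \<in> L" using I L by (auto simp: two_sided_ideal_def)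
    then have il: "uf_prod i l \<in> I" "uf_prod i l \<in> L"
      using I L left by (auto simp: two_sided_ideal_def)
    have "L \<subseteq> I"
    proof
      fix H assume "H \<in> L"
      then show "H \<in> I" using minimal[OF il(2)] I il(1) by (auto simp: two_sided_ideal_def)
    qed
    then show ?thesis using I by (auto simp: K_def two_sided_ideal_def)
  qed
  have "smallest_ideal beta uf_prod = K"
    unfolding smallest_ideal_def using K least by (intro Least_equality) auto
  then show "two_sided_ideal beta uf_prod (smallest_ideal beta uf_prod)"
    and "\<And>I. two_sided_ideal beta uf_prod I \<Longrightarrow> smallest_ideal beta uf_prod \<subseteq> I"
    using K least by auto
qed

lemma two_sided_ideal_uf_prod:
  assumes I: "two_sided_ideal beta uf_prod I" and J: "two_sided_ideal beta uf_prod J"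
  shows "two_sided_ideal beta uf_prod {uf_prod F G | F G. F \<in> I \<and> G \<in> J}" (is "two_sided_ideal _ _ ?P")
  unfolding two_sided_ideal_def
proof (intro conjI ballI)
  show "?P \<noteq> {}" using I J by (auto simp: two_sided_ideal_def)
  have "I \<subseteq> beta" "J \<subseteq> beta" using I J by (simp_all add: two_sided_ideal_def)
  then show "?P \<subseteq> beta" using uf_prod_closed by blast
  fix x s assume "x \<in> ?P" and s: "s \<in> beta"
  then obtain F G where x: "x = uf_prod F G" "F \<in> I" "G \<in> J" by blast
  have "uf_prod s x = uf_prod (uf_prod s F) G" "uf_prod s F \<in> I"
    using I s x by (simp_all add: uf_prod_assoc two_sided_ideal_def)
  then show "uf_prod s x \<in> ?P" using x by blast
  have "uf_prod x s = uf_prod F (uf_prod G s)" "uf_prod G s \<in> J"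
    using J s x by (simp_all add: uf_prod_assoc two_sided_ideal_def)
  then show "uf_prod x s \<in> ?P" using x by blast
qed

end

section \<open>The two semigroups of ultrafilters on the positive integers\<close>

interpretation mult: semigroup_on posnat "(*)"
  by standard auto

interpretation add: semigroup_on posnat "(+)"
  by standard auto

lemma mult_beta_eq: "mult.beta = betaN" and add_beta_eq: "add.beta = betaN"
  by (simp_all add: mult.beta_def add.beta_def betaN_def)

lemma uf_mult_eq: "uf_mult = mult.uf_prod"
proof -
  have "set_quot A n = mult.left_quot A n" if "A \<subseteq> posnat" "n \<in> posnat" for A n
    using that by (force simp: set_quot_def mult.left_quot_def)
  then show ?thesis by (auto simp: fun_eq_iff uf_mult_def mult.uf_prod_def cong: conj_cong)
qed

lemma uf_add_eq: "uf_add = add.uf_prod"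
proof -
  have "set_shift A n = add.left_quot A n" for A n
  proof (rule set_eqI)
    fix m
    have "m \<in> set_shift A n \<longleftrightarrow> (\<exists>a. a \<in> A \<and> m > 0 \<and> a = n + m)"
      by (auto simp: set_shift_def intro: exI[of _ "n + m"])
    then show "m \<in> set_shift A n \<longleftrightarrow> m \<in> add.left_quot A n" by (auto simp: add.left_quot_def)
  qed
  then show ?thesis by (auto simp: fun_eq_iff uf_add_def add.uf_prod_def cong: conj_cong)
qed

section \<open>The greatest divisibility class\<close>

definition multiples :: "nat \<Rightarrow> nat set" where
  "multiples n = {m \<in> posnat. n dvd m}"

text \<open>
  Only the principal ultrafilters have to be tested, as every nonempty set closed under multiples
  contains all the multiples of one of its elements.
\<close>

lemma max_class_iff: "G \<in> max_class \<longleftrightarrow> G \<in> betaN \<and> (\<forall>n>0. multiples n \<in> G)"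
proof (intro iffI conjI allI impI)
  assume G: "G \<in> max_class"
  then show "G \<in> betaN" by (simp add: max_class_def)
  fix n :: nat assume "n > 0"
  then have "principal_ultrafilter posnat n \<in> betaN" "{n} \<in> principal_ultrafilter posnat n"
    by (simp add: betaN_def ultrafilter_on_principal) (simp add: principal_ultrafilter_def \<open>n > 0\<close>)
  then have "mult_upset {n} \<in> G" using G by (auto simp: max_class_def uf_dvd_def)
  then show "multiples n \<in> G" by (simp add: mult_upset_def multiples_def)
next
  assume G: "G \<in> betaN \<and> (\<forall>n>0. multiples n \<in> G)"
  then have g: "ultrafilter_on posnat G" by (simp add: betaN_def)
  have "mult_upset A \<in> G" if F: "F \<in> betaN" and A: "A \<in> F" for F A
  proof -
    have f: "ultrafilter_on posnat F" using F by (simp add: betaN_def)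
    obtain a where "a \<in> A" "a > 0"
      using ultrafilter_on_nonempty[OF f A] ultrafilter_on_subset[OF f A] by blast
    then have "multiples a \<in> G" "multiples a \<subseteq> mult_upset A" "mult_upset A \<subseteq> posnat"
      using G by (auto simp: multiples_def mult_upset_def)
    then show ?thesis using ultrafilter_on_mono[OF g] by blast
  qed
  then show "G \<in> max_class" using G by (simp add: max_class_def uf_dvd_def)
qed

lemma max_class_mem_has_multiple:
  assumes "G \<in> max_class" "D \<in> G" "n > 0"
  obtains d where "d \<in> D" "d > 0" "n dvd d"
proof -
  have g: "ultrafilter_on posnat G" and "multiples n \<in> G"
    using assms by (auto simp: max_class_iff betaN_def)
  then have "D \<inter> multiples n \<noteq> {}"
    using ultrafilter_on_Int[OF g assms(2)] ultrafilter_on_nonempty[OF g] by blast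
  with that show thesis by (auto simp: multiples_def)
qed

text \<open>
  The traces of the sets of multiples on \<open>A\<close> form a filter base, because common multiples of \<open>n\<close> and
  \<open>m\<close> are the multiples of their least common multiple.
\<close>

lemma max_class_with_member:
  assumes A: "A \<subseteq> posnat" and hit: "\<And>n. n > 0 \<Longrightarrow> \<exists>a\<in>A. n dvd a"
  obtains G where "G \<in> max_class" "A \<in> G"
proof -
  have Int: "A \<inter> multiples n \<inter> (A \<inter> multiples m) = A \<inter> multiples (lcm n m)" for n m
    by (auto simp: multiples_def)
  have "filter_base_on posnat ((\<lambda>n. A \<inter> multiples n) ` posnat)"
    unfolding filter_base_on_def
  proof (intro conjI ballI)
    have "A \<inter> multiples n \<noteq> {}" if "n > 0" for n
      using hit[OF that] A by (auto simp: multiples_def)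
    then show "{} \<notin> (\<lambda>n. A \<inter> multiples n) ` posnat" by auto
    fix B C assume "B \<in> (\<lambda>n. A \<inter> multiples n) ` posnat" "C \<in> (\<lambda>n. A \<inter> multiples n) ` posnat"
    then obtain n m where "n > 0" "m > 0" "B = A \<inter> multiples n" "C = A \<inter> multiples m" by auto
    then have "B \<inter> C = A \<inter> multiples (lcm n m)" "lcm n m > 0" by (simp_all add: Int lcm_pos_nat)
    then show "B \<inter> C \<in> (\<lambda>n. A \<inter> multiples n) ` posnat" by blast
  qed (use A in auto)
  then obtain G where G: "ultrafilter_on posnat G" "(\<lambda>n. A \<inter> multiples n) ` posnat \<subseteq> G"
    by (rule ultrafilter_on_extends_filter_base)
  then have mem: "A \<inter> multiples n \<in> G" if "n > 0" for n using that by blast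
  have "multiples n \<in> G" if "n > 0" for n
    by (rule ultrafilter_on_mono[OF G(1) mem[OF that]]) (auto simp: multiples_def)
  moreover have "A \<in> G"
    by (rule ultrafilter_on_mono[OF G(1) mem[of 1]]) (use A in auto)
  ultimately show thesis using that G(1) by (auto simp: max_class_iff betaN_def)
qed

text \<open>
  Quotients of the set of multiples of \<open>n\<close> contain that set, and a quotient by a multiple of \<open>n\<close> is
  everything.
\<close>

lemma two_sided_ideal_max_class: "two_sided_ideal betaN uf_mult max_class"
  unfolding two_sided_ideal_def
proof (intro conjI ballI)
  show "max_class \<noteq> {}" using max_class_with_member[of posnat] by (metis dvd_refl empty_iff greaterThan_iff subset_refl)
  show "max_class \<subseteq> betaN" by (auto simp: max_class_def)
  fix G F assume "G \<in> max_class" and F: "F \<in> betaN"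
  then have G: "G \<in> betaN" and mem: "\<And>n. n > 0 \<Longrightarrow> multiples n \<in> G" by (auto simp: max_class_iff)
  note f = F[unfolded betaN_def mem_Collect_eq] and g = G[unfolded betaN_def mem_Collect_eq]
  have closed: "uf_mult F G \<in> betaN" "uf_mult G F \<in> betaN"
    using mult.uf_prod_closed F G by (auto simp: uf_mult_eq mult_beta_eq)
  have pos: "multiples n \<subseteq> posnat" for n by (auto simp: multiples_def)
  have "multiples n \<in> uf_mult F G" if "n > 0" for n
  proof -
    have "mult.left_quot (multiples n) k \<in> G" if "k > 0" for k
      by (rule ultrafilter_on_mono[OF g mem[OF \<open>n > 0\<close>]])
        (use that in \<open>auto simp: multiples_def mult.left_quot_def\<close>)
    then have "{k \<in> posnat. mult.left_quot (multiples n) k \<in> G} = posnat" by auto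
    then show ?thesis
      using pos ultrafilter_on_carrier[OF f] by (simp add: uf_mult_eq mult.uf_prod_def)
  qed
  then show "uf_mult F G \<in> max_class" using closed by (simp add: max_class_iff)
  have "multiples n \<in> uf_mult G F" if "n > 0" for n
  proof -
    have "mult.left_quot (multiples n) k = posnat" if "k \<in> multiples n" for k
      using that by (auto simp: multiples_def mult.left_quot_def)
    then have "multiples n \<subseteq> {k \<in> posnat. mult.left_quot (multiples n) k \<in> F}"
      using ultrafilter_on_carrier[OF f] pos by auto
    then have "{k \<in> posnat. mult.left_quot (multiples n) k \<in> F} \<in> G"
      by (rule ultrafilter_on_mono[OF g mem[OF \<open>n > 0\<close>]]) auto
    then show ?thesis using pos by (simp add: uf_mult_eq mult.uf_prod_def)
  qed
  then show "uf_mult G F \<in> max_class" using closed by (simp add: max_class_iff)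
qed

section \<open>The set of factorials\<close>

text \<open>
  Two different factorials \<open>k! < l!\<close> have quotient at least \<open>k + 1\<close>, so their quotient \<open>m / n\<close>
  bounds \<open>k\<close>.
\<close>

lemma common_factor_of_factorials_le:
  fixes n m x :: nat
  assumes "0 < n" "n < m" "0 < x" "n * x = fact k" "m * x = fact l"
  shows "x \<le> fact m"
proof -
  have "fact k < (fact l :: nat)" using assms by (metis mult_less_mono1)
  then have "k < l" by (meson fact_mono_nat leI not_le)
  then have "fact (Suc k) \<le> (fact l :: nat)" by (intro fact_mono_nat) simp
  then have "Suc k * n * x \<le> m * x" using assms(4,5) by (metis fact_Suc mult.assoc of_nat_id)
  then have "Suc k * n \<le> m" using \<open>0 < x\<close> by simp
  moreover have "Suc k * 1 \<le> Suc k * n" using \<open>0 < n\<close> by (intro mult_le_mono2) simp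
  ultimately have "k \<le> m" by simp
  then have "fact k \<le> (fact m :: nat)" by (rule fact_mono_nat)
  moreover have "x \<le> n * x" using \<open>0 < n\<close> by simp
  ultimately show ?thesis using assms(4) by simp
qed

lemma factorials_notin_uf_mult_max_class:
  assumes F: "F \<in> max_class" and G: "G \<in> max_class"
  shows "range fact \<notin> uf_mult F G"
proof
  assume "range fact \<in> uf_mult F G"
  then have D: "{n \<in> posnat. mult.left_quot (range fact) n \<in> G} \<in> F" (is "?D \<in> F")
    by (simp add: uf_mult_eq mult.uf_prod_def)
  obtain n where n: "n \<in> ?D" by (rule max_class_mem_has_multiple[OF F D, of 1]) simp
  obtain m where m: "m \<in> ?D" "Suc n dvd m"
    by (rule max_class_mem_has_multiple[OF F D, of "Suc n"]) simp
  then have "n < m" using dvd_imp_le[of "Suc n" m] by auto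
  \<comment> \<open>A positive multiple of \<open>m! + 1\<close> exceeds the bound on common factors.\<close>
  have "mult.left_quot (range fact) n \<inter> mult.left_quot (range fact) m \<in> G"
    using n m G by (auto simp: max_class_iff betaN_def intro: ultrafilter_on_Int)
  then obtain x where x: "x \<in> mult.left_quot (range fact) n \<inter> mult.left_quot (range fact) m"
      "x > 0" "Suc (fact m) dvd x"
    by (rule max_class_mem_has_multiple[OF G, of _ "Suc (fact m)"]) auto
  then obtain k l where "n * x = fact k" "m * x = fact l" by (auto simp: mult.left_quot_def)
  then have "x \<le> fact m"
    using common_factor_of_factorials_le n \<open>n < m\<close> \<open>x > 0\<close> by auto
  then show False using dvd_imp_le[OF x(3,2)] by simp
qed

section \<open>The closure of the smallest ideal\<close>

lemma topspace_betaN_topology: "topspace betaN_topology = betaN"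
  unfolding betaN_topology_def topology_generated_by_topspace
  by (auto simp: betaN_def dest: ultrafilter_on_carrier)

lemma closure_of_betaN_mem:
  assumes F: "F \<in> betaN_topology closure_of S" and "A \<in> F"
  obtains G where "G \<in> S" "A \<in> G"
proof -
  have Fb: "F \<in> betaN" using F by (simp add: in_closure_of topspace_betaN_topology)
  then have "A \<subseteq> posnat" using \<open>A \<in> F\<close> by (auto simp: betaN_def dest: ultrafilter_on_subset)
  then have "openin betaN_topology {F \<in> betaN. A \<in> F}"
    unfolding betaN_topology_def by (intro topology_generated_by_Basis) blast
  moreover have "F \<in> {F \<in> betaN. A \<in> F}" using Fb \<open>A \<in> F\<close> by simp
  ultimately obtain G where "G \<in> S" "G \<in> {F \<in> betaN. A \<in> F}"
    using F unfolding in_closure_of by meson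
  then show thesis by (auto intro: that)
qed

text \<open>
  Closedness of \<open>MAX\<close>: an ultrafilter missing the multiples of \<open>n\<close> has a basic neighbourhood, given
  by the complement of that set, which is disjoint from \<open>MAX\<close>.
\<close>

lemma closure_of_subset_max_class:
  assumes "S \<subseteq> max_class"
  shows "betaN_topology closure_of S \<subseteq> max_class"
proof
  fix F assume F: "F \<in> betaN_topology closure_of S"
  then have Fb: "F \<in> betaN" by (simp add: in_closure_of topspace_betaN_topology)
  have "multiples n \<in> F" if "n > 0" for n
  proof (rule ccontr)
    assume "multiples n \<notin> F"
    then have "posnat - multiples n \<in> F"
      using Fb by (subst ultrafilter_on_Diff_iff) (auto simp: betaN_def multiples_def)
    then obtain G where "G \<in> S" "posnat - multiples n \<in> G" by (rule closure_of_betaN_mem[OF F])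
    then have "G \<in> max_class" using assms by blast
    then obtain d where "d \<in> posnat - multiples n" "d > 0" "n dvd d"
      using \<open>posnat - multiples n \<in> G\<close> \<open>n > 0\<close> by (rule max_class_mem_has_multiple)
    then show False by (simp add: multiples_def)
  qed
  with Fb show "F \<in> max_class" by (simp add: max_class_iff)
qed

theorem corollary5p4:
  shows "betaN_topology closure_of (smallest_ideal betaN uf_mult) \<subset> max_class
    \<and> \<not> smallest_ideal betaN uf_add \<subseteq> max_class"
proof
  let ?K = "smallest_ideal betaN uf_mult"
  note ideal = two_sided_ideal_max_class[unfolded uf_mult_eq mult_beta_eq[symmetric]]
  have K_max: "?K \<subseteq> max_class"
    using mult.smallest_ideal_subset[OF ideal] by (simp add: uf_mult_eq mult_beta_eq)
  have K_prod: "?K \<subseteq> {uf_mult F G | F G. F \<in> max_class \<and> G \<in> max_class}"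
    using mult.smallest_ideal_subset[OF mult.two_sided_ideal_uf_prod[OF ideal ideal]]
    by (simp add: uf_mult_eq mult_beta_eq)
  have "\<exists>a\<in>range fact. n dvd a" if "n > 0" for n :: nat
    using that by (intro bexI[of _ "fact n"] dvd_fact) auto
  then obtain G where G: "G \<in> max_class" "range fact \<in> G"
    by (rule max_class_with_member[of "range fact", rotated]) auto
  have "G \<notin> betaN_topology closure_of ?K"
  proof
    assume "G \<in> betaN_topology closure_of ?K"
    then obtain H where "H \<in> ?K" "range fact \<in> H" using G(2) by (rule closure_of_betaN_mem)
    with K_prod factorials_notin_uf_mult_max_class show False by blast
  qed
  with G(1) closure_of_subset_max_class[OF K_max]
  show "betaN_topology closure_of ?K \<subset> max_class" by blast
next
  let ?K = "smallest_ideal betaN uf_add" and ?one = "principal_ultrafilter posnat 1"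
  have K: "two_sided_ideal betaN uf_add ?K"
    using add.two_sided_ideal_smallest_ideal by (simp add: uf_add_eq add_beta_eq)
  then obtain F where F: "F \<in> ?K" by (auto simp: two_sided_ideal_def)
  have "?one \<in> betaN" by (simp add: betaN_def ultrafilter_on_principal)
  with K F have F1: "uf_add F ?one \<in> ?K" by (auto simp: two_sided_ideal_def)
  show "\<not> ?K \<subseteq> max_class"
  proof
    assume "?K \<subseteq> max_class"
    with F F1 have "F \<in> max_class" "multiples 2 \<in> uf_add F ?one" by (auto simp: max_class_iff)
    \<comment> \<open>The set of all \<open>n\<close> with \<open>n + 1\<close> even belongs to \<open>F\<close>, yet so do the even numbers.\<close>
    then have "{n \<in> posnat. add.left_quot (multiples 2) n \<in> ?one} \<in> F"
      by (simp add: uf_add_eq add.uf_prod_def)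
    then obtain d where "even d" "add.left_quot (multiples 2) d \<in> ?one"
      using max_class_mem_has_multiple[OF \<open>F \<in> max_class\<close>, of _ 2] by auto
    then show False by (auto simp: principal_ultrafilter_def add.left_quot_def multiples_def)
  qed
qed

end
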